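(* Assume the two-group Curie–Weiss model described in the context, with $\alpha_1>0$, $\alpha_2>0$, in the high temperature regime $J_1<\frac{1}{\alpha_1}$, $J_2<\frac{1}{\alpha_2}$, $\bar J^2<\big(\frac{1}{\alpha_1}-J_1\big)\big(\frac{1}{\alpha_2}-J_2\big)$. Then \[ \Big(\frac{1}{\sqrt{N_1}}\sum_{i=1}^{N_1}X_i,\ \frac{1}{\sqrt{N_2}}\sum_{j=1}^{N_2}Y_j\Big)\Longrightarrow \mathcal N\big((0,0),C\big)\qquad(N\to\infty), \] where \[ C=\frac{1}{(1-\alpha_1J_1)(1-\alpha_2J_2)-\alpha_1\alpha_2\bar J^2}\begin{pmatrix}1-\alpha_2J_2 & \sqrt{\alpha_1\alpha_2}\,\bar J\\ \sqrt{\alpha_1\alpha_2}\,\bar J & 1-\alpha_1J_1\end{pmatrix}. \]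
   Context: Two-group Curie–Weiss model: for each $N\in\mathbb N$ let $N_1=N_1(N)$, $N_2=N_2(N)$ be positive integers with $N_1+N_2\le N$, $N_1,N_2\to\infty$, and such that the limits $\alpha_1=\lim_{N\to\infty}N_1/N$, $\alpha_2=\lim_{N\to\infty}N_2/N$ exist. The coupling matrix is $J=\begin{pmatrix}J_1&\bar J\\ \bar J&J_2\end{pmatrix}$ with $J_1,J_2,\bar J>0$ and $\Delta:=J_1J_2-\bar J^2>0$. The spins $X_1,\dots,X_{N_1},Y_1,\dots,Y_{N_2}\in\{-1,1\}$ have joint law \[ \mathbb P(X=x,Y=y)=Z^{-1}\exp\Big(\frac{1}{2N}\Big[J_1\Big(\sum_{i}x_i\Big)^2+J_2\Big(\sum_{j}y_j\Big)^2+2\bar J\Big(\sum_{i}x_i\Big)\Big(\sum_{j}y_j\Big)\Big]\Big), \] $Z$ the normalising constant. $\mathcal N(\mu,C)$ denotes the bivariate normal law with mean $\mu$ and covariance matrix $C$; $\Longrightarrow$ is convergence in distribution. *)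

theory Defs
  imports "HOL-Probability.Probability"
begin

definition spins :: "nat \<Rightarrow> real list set" where
  "spins n = {xs. length xs = n \<and> set xs \<subseteq> {-1, 1}}"

definition cw_weight :: "nat \<Rightarrow> real \<Rightarrow> real \<Rightarrow> real \<Rightarrow> real list \<times> real list \<Rightarrow> real" where
  "cw_weight N J1 J2 Jb z =
     exp ((J1 * (sum_list (fst z))\<^sup>2 + J2 * (sum_list (snd z))\<^sup>2
           + 2 * Jb * sum_list (fst z) * sum_list (snd z)) / (2 * real N))"

definition cw_Z :: "nat \<Rightarrow> nat \<Rightarrow> nat \<Rightarrow> real \<Rightarrow> real \<Rightarrow> real \<Rightarrow> real" where
  "cw_Z N N1 N2 J1 J2 Jb = (\<Sum>z \<in> spins N1 \<times> spins N2. cw_weight N J1 J2 Jb z)"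

definition cw_law :: "nat \<Rightarrow> nat \<Rightarrow> nat \<Rightarrow> real \<Rightarrow> real \<Rightarrow> real \<Rightarrow> (real list \<times> real list) measure" where
  "cw_law N N1 N2 J1 J2 Jb =
     density (count_space (spins N1 \<times> spins N2))
       (\<lambda>z. ennreal (cw_weight N J1 J2 Jb z / cw_Z N N1 N2 J1 J2 Jb))"

definition cw_fluct_law :: "nat \<Rightarrow> nat \<Rightarrow> nat \<Rightarrow> real \<Rightarrow> real \<Rightarrow> real \<Rightarrow> (real \<times> real) measure" where
  "cw_fluct_law N N1 N2 J1 J2 Jb =
     distr (cw_law N N1 N2 J1 J2 Jb) borel
       (\<lambda>z. (sum_list (fst z) / sqrt (real N1), sum_list (snd z) / sqrt (real N2)))"

text \<open>Density of the centred bivariate normal law with covariance matrix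
  [[a, b], [b, c]] (assumed positive definite).\<close>
definition normal2_density :: "real \<Rightarrow> real \<Rightarrow> real \<Rightarrow> real \<times> real \<Rightarrow> real" where
  "normal2_density a b c p =
     (let d = a * c - b\<^sup>2; x = fst p; y = snd p in
        exp (- (c * x\<^sup>2 - 2 * b * x * y + a * y\<^sup>2) / (2 * d)) / (2 * pi * sqrt d))"

definition normal2 :: "real \<Rightarrow> real \<Rightarrow> real \<Rightarrow> (real \<times> real) measure" where
  "normal2 a b c = density lborel (\<lambda>p. ennreal (normal2_density a b c p))"

definition weak_conv2 :: "(nat \<Rightarrow> (real \<times> real) measure) \<Rightarrow> (real \<times> real) measure \<Rightarrow> bool" where
  "weak_conv2 M \<mu> \<longleftrightarrow>
     (\<forall>f :: real \<times> real \<Rightarrow> real. continuous_on UNIV f \<and> bounded (range f) \<longrightarrow>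
        (\<lambda>n. integral\<^sup>L (M n) f) \<longlonglongrightarrow> integral\<^sup>L \<mu> f)"

end

theory Submission
  imports Defs "HOL-Real_Asymp.Real_Asymp"
begin

text \<open>
  Under the uniform measure on the spins, the normalised magnetisations \<open>U\<close>, \<open>V\<close> of the two groups
  are independent and each is asymptotically standard normal. The Curie--Weiss law is this product
  measure reweighted by \<open>exp (Q\<^sub>N (U, V) / 2)\<close> for a quadratic form \<open>Q\<^sub>N\<close> converging to some \<open>Q\<close>. The
  high temperature condition says precisely that \<open>Q (u, v) \<le> l (u\<^sup>2 + v\<^sup>2)\<close> for some \<open>l < 1\<close>, and
  \<open>exp (l U\<^sup>2 / 2)\<close> has convergent expectation because its Hubbard-Stratonovich transform turns it
  into a Gaussian average of powers of \<open>cosh\<close>. So the reweighting passes to the limit,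
  where the tilted Gaussian density is that of the claimed normal law.
\<close>

section \<open>Limits and bounds for powers of cos and cosh\<close>

lemma cos_scaled_power_limit:
  fixes t :: real
  shows "(\<lambda>n. cos (t / sqrt (real n)) ^ n) \<longlonglongrightarrow> exp (- t\<^sup>2 / 2)"
proof -
  have pos: "(\<lambda>n. cos (t / sqrt (real n)) ^ n) \<longlonglongrightarrow> exp (- t\<^sup>2 / 2)" if "t > 0" for t :: real
    using that by (real_asymp simp: power2_eq_square)
  \<comment> \<open>The asymptotic expansion is carried out with the sign of \<open>t\<close> fixed;
    negative \<open>t\<close> follows because cos is even.\<close>
  consider "t > 0" | "t = 0" | "- t > 0" by linarith
  then show ?thesis
  proof cases
    case 3
    from pos[OF this] show ?thesis by simp
  qed (use pos in auto)
qed

lemma cosh_scaled_power_limit: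
  fixes t :: real
  shows "(\<lambda>n. cosh (t / sqrt (real n)) ^ n) \<longlonglongrightarrow> exp (t\<^sup>2 / 2)"
proof -
  have pos: "(\<lambda>n. cosh (t / sqrt (real n)) ^ n) \<longlonglongrightarrow> exp (t\<^sup>2 / 2)" if "t > 0" for t :: real
    using that unfolding cosh_field_def by (real_asymp simp: power2_eq_square)
  consider "t > 0" | "t = 0" | "- t > 0" by linarith
  then show ?thesis
  proof cases
    case 3
    from pos[OF this] show ?thesis by simp
  qed (use pos in auto)
qed

text \<open>Termwise comparison of the two Taylor series in \<open>x^2\<close>, which reduces to
  \<open>2^k k! <= (2k)!\<close>. It supplies the majorant, uniform in \<open>n\<close>, for the
  powers of cosh below.\<close>

lemma cosh_le_exp_half_square: "cosh x \<le> exp (x\<^sup>2 / 2)" for x :: real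
proof -
  have fct: "2 ^ k * fact k \<le> (fact (2 * k) :: real)" for k
  proof (induction k)
    case (Suc k)
    have "2 ^ Suc k * fact (Suc k) = (2 * real k + 2) * (2 ^ k * fact k)"
      by (simp add: algebra_simps)
    also have "\<dots> \<le> (2 * real k + 2) * (1 * fact (2 * k))"
      using Suc by (intro mult_left_mono) auto
    also have "\<dots> \<le> (2 * real k + 2) * ((2 * real k + 1) * fact (2 * k))"
      by (intro mult_left_mono mult_right_mono) auto
    also have "\<dots> = fact (2 * Suc k)"
      by (simp add: algebra_simps)
    finally show ?case .
  qed simp
  \<comment> \<open>The odd terms of the cosh series vanish, so the series may be reindexed along
    the even numbers.\<close>
  have "(\<lambda>k. x ^ (2 * k) /\<^sub>R fact (2 * k)) sums cosh x"
    using cosh_converges[of x]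
    by (subst (asm) sums_mono_reindex[of "\<lambda>k. 2 * k", symmetric])
       (auto simp: strict_mono_def elim!: evenE)
  moreover have "(\<lambda>k. (x\<^sup>2 / 2) ^ k /\<^sub>R fact k) sums exp (x\<^sup>2 / 2)"
    by (rule exp_converges)
  moreover have "x ^ (2 * k) /\<^sub>R fact (2 * k) \<le> (x\<^sup>2 / 2) ^ k /\<^sub>R fact k" for k
  proof -
    have "x ^ (2 * k) / fact (2 * k) \<le> x ^ (2 * k) / (2 ^ k * fact k)"
      using fct[of k] by (intro divide_left_mono) (auto intro!: mult_pos_pos)
    also have "\<dots> = (x\<^sup>2 / 2) ^ k / fact k"
      by (simp add: power_divide power_mult)
    finally show ?thesis by (simp only: real_scaleR_def divide_inverse mult.commute)
  qed
  ultimately show ?thesis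
    by (rule sums_le[rotated])
qed

section \<open>Dominated convergence with varying majorants\<close>

text \<open>By Scheffe's lemma the majorants \<open>G n\<close> converge to \<open>g\<close> in L1.
  Truncating \<open>F n\<close> at the limiting majorant \<open>g\<close> makes ordinary dominated
  convergence applicable, and the truncation error is at most the L1 distance from
  \<open>G n\<close> to \<open>g\<close>.\<close>

lemma tendsto_integral_dominated_by_convergent:
  fixes F G :: "nat \<Rightarrow> 'a \<Rightarrow> real"
  assumes [measurable]: "\<And>n. F n \<in> borel_measurable M" "f \<in> borel_measurable M"
    and G: "\<And>n. integrable M (G n)" "\<And>n x. x \<in> space M \<Longrightarrow> 0 \<le> G n x"
    and g: "integrable M g" "\<And>x. x \<in> space M \<Longrightarrow> 0 \<le> g x"
    and Ff: "AE x in M. (\<lambda>n. F n x) \<longlonglongrightarrow> f x"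
    and Gg: "AE x in M. (\<lambda>n. G n x) \<longlonglongrightarrow> g x"
    and lim: "(\<lambda>n. integral\<^sup>L M (G n)) \<longlonglongrightarrow> integral\<^sup>L M g"
    and bound: "\<forall>\<^sub>F n in sequentially. \<forall>x\<in>space M. \<bar>F n x\<bar> \<le> G n x"
  shows "(\<lambda>n. integral\<^sup>L M (F n)) \<longlonglongrightarrow> integral\<^sup>L M f"
proof -
  have [measurable]: "\<And>n. G n \<in> borel_measurable M" "g \<in> borel_measurable M"
    using G(1) g(1) by auto
  have nnG: "(\<integral>\<^sup>+ x. norm (G n x) \<partial>M) = ennreal (integral\<^sup>L M (G n))" for n
    using G by (subst nn_integral_eq_integral[symmetric]) (auto intro!: nn_integral_cong)
  have nng: "(\<integral>\<^sup>+ x. norm (g x) \<partial>M) = ennreal (integral\<^sup>L M g)"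
    using g by (subst nn_integral_eq_integral[symmetric]) (auto intro!: nn_integral_cong)
  have "(\<lambda>n. ennreal (integral\<^sup>L M (G n))) \<longlonglongrightarrow> ennreal (integral\<^sup>L M g)"
    using lim by (rule tendsto_ennrealI)
  then have "(\<lambda>n. \<integral>\<^sup>+ x. norm (G n x - g x) \<partial>M) \<longlonglongrightarrow> 0"
    by (intro Scheffe_lemma1 G(1) g(1) Gg) (simp only: nnG nng lim_imp_Limsup[OF sequentially_bot] order_refl)
  then have "(\<lambda>n. ennreal (\<integral>x. \<bar>G n x - g x\<bar> \<partial>M)) \<longlonglongrightarrow> ennreal 0"
    using G(1) g(1) by (subst nn_integral_eq_integral[symmetric]) auto
  then have scheffe: "(\<lambda>n. \<integral>x. \<bar>G n x - g x\<bar> \<partial>M) \<longlonglongrightarrow> 0"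
    by (subst (asm) tendsto_ennreal_iff) auto
  \<comment> \<open>\<open>H n\<close> is \<open>F n\<close> clipped to the interval from
    \<open>- g\<close> to \<open>g\<close>.\<close>
  define H where "H n x = max (- g x) (min (g x) (F n x))" for n x
  have [measurable]: "H n \<in> borel_measurable M" for n
    unfolding H_def by measurable
  have Hg: "\<bar>H n x\<bar> \<le> g x" if "x \<in> space M" for n x
    using g(2)[OF that] by (auto simp: H_def)
  have intH: "integrable M (H n)" for n
    using g(1) by (rule Bochner_Integration.integrable_bound) (use Hg g(2) in \<open>auto intro!: AE_I2\<close>)
  have "(\<lambda>n. integral\<^sup>L M (H n)) \<longlonglongrightarrow> integral\<^sup>L M f"
  proof (rule integral_dominated_convergence[where w = g])
    show "AE x in M. (\<lambda>n. H n x) \<longlonglongrightarrow> f x"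
      using Ff Gg AE_space
    proof eventually_elim
      case (elim x)
      have "\<forall>\<^sub>F n in sequentially. \<bar>F n x\<bar> \<le> G n x"
        using bound elim(3) by (auto elim: eventually_mono)
      \<comment> \<open>The bounds pass to the limit, so clipping leaves \<open>f\<close> itself
        unchanged.\<close>
      then have "\<bar>f x\<bar> \<le> g x"
        by (intro tendsto_le[OF _ elim(2) tendsto_rabs[OF elim(1)]]) auto
      moreover have "(\<lambda>n. H n x) \<longlonglongrightarrow> max (- g x) (min (g x) (f x))"
        unfolding H_def by (intro tendsto_intros elim)
      ultimately show ?case by (simp add: min_absorb2 max_absorb2 abs_le_iff)
    qed
  qed (use Hg g(1) in auto)
  moreover have "(\<lambda>n. integral\<^sup>L M (F n) - integral\<^sup>L M (H n)) \<longlonglongrightarrow> 0"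
  proof (rule tendsto_rabs_zero_cancel, rule tendsto_sandwich[OF _ _ tendsto_const scheffe])
    show "\<forall>\<^sub>F n in sequentially. \<bar>integral\<^sup>L M (F n) - integral\<^sup>L M (H n)\<bar> \<le> (\<integral>x. \<bar>G n x - g x\<bar> \<partial>M)"
      using bound
    proof eventually_elim
      case (elim n)
      have intF: "integrable M (F n)"
        using G(1)[of n] by (rule Bochner_Integration.integrable_bound) (use elim in \<open>force intro!: AE_I2\<close>)+
      have "\<bar>integral\<^sup>L M (F n) - integral\<^sup>L M (H n)\<bar> = \<bar>\<integral>x. F n x - H n x \<partial>M\<bar>"
        using intF intH by simp
      also have "\<dots> \<le> (\<integral>x. \<bar>F n x - H n x\<bar> \<partial>M)"
        by (rule integral_abs_bound)
      also have "\<dots> \<le> (\<integral>x. \<bar>G n x - g x\<bar> \<partial>M)"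
      proof (rule integral_mono)
        fix x assume x: "x \<in> space M"
        \<comment> \<open>Where clipping has an effect, the left side is
          \<open>\<bar>F n x\<bar> - g x\<close>, hence at most \<open>G n x - g x\<close>;
          elsewhere it is zero.\<close>
        show "\<bar>F n x - H n x\<bar> \<le> \<bar>G n x - g x\<bar>"
          using elim x g(2)[OF x] by (auto simp: H_def max_def min_def)
      qed (use intF intH G(1) g(1) in auto)
      finally show ?case .
    qed
  qed auto
  ultimately show ?thesis
    using tendsto_add by fastforce
qed

section \<open>Sums over spin configurations\<close>

lemma spins_0: "spins 0 = {[]}"
  by (auto simp: spins_def)

lemma spins_Suc: "spins (Suc n) = (\<lambda>(s, xs). s # xs) ` ({-1, 1} \<times> spins n)"
  by (auto simp: spins_def length_Suc_conv image_iff)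

lemma finite_spins [simp]: "finite (spins n)"
  by (induction n) (auto simp: spins_0 spins_Suc)

lemma sum_spins_Suc:
  "(\<Sum>xs\<in>spins (Suc n). h xs) = (\<Sum>s\<in>{-1, 1}. \<Sum>xs\<in>spins n. h (s # xs))"
  by (auto simp: spins_Suc sum.reindex inj_on_def sum.cartesian_product intro!: sum.cong)

lemma card_spins: "card (spins n) = 2 ^ n"
proof (induction n)
  case (Suc n)
  have "inj_on (\<lambda>(s, xs). s # xs) ({-1, 1 :: real} \<times> spins n)"
    by (auto simp: inj_on_def)
  then show ?case
    using Suc by (simp add: spins_Suc card_image card_cartesian_product)
qed (simp add: spins_0)

lemma spins_nonempty [simp]: "spins n \<noteq> {}"
  using card_spins[of n] by auto

text \<open>The sum factorises over the spins. The general field allows real \<open>c\<close>, for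
  exponential moments, as well as imaginary \<open>c\<close>, for characteristic functions.\<close>

lemma sum_spins_exp:
  fixes c :: "'a :: {real_normed_field, banach}"
  shows "(\<Sum>xs\<in>spins n. exp (c * of_real (sum_list xs))) = (2 * cosh c) ^ n"
proof (induction n)
  case (Suc n)
  have "(\<Sum>xs\<in>spins (Suc n). exp (c * of_real (sum_list xs)))
      = (exp (- c) + exp c) * (\<Sum>xs\<in>spins n. exp (c * of_real (sum_list xs)))"
    by (simp add: sum_spins_Suc ring_distribs exp_add sum_distrib_left exp_diff exp_minus field_simps sum.distrib)
  also have "\<dots> = (2 * cosh c) ^ Suc n"
    by (simp add: Suc cosh_field_def add.commute)
  finally show ?case .
qed (simp add: spins_0)

section \<open>The normalised magnetisation under the uniform measure\<close>

text \<open>Since division by zero yields zero, \<open>walk_law 0\<close> is the point mass at 0, so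
  the facts below hold for every \<open>n\<close>.\<close>

definition walk_law :: "nat \<Rightarrow> real measure" where
  "walk_law n = distr (uniform_count_measure (spins n)) borel (\<lambda>xs. sum_list xs / sqrt (real n))"

lemma measurable_uniform_count_measure [simp]:
  "f \<in> measurable (uniform_count_measure A) M \<longleftrightarrow> f \<in> A \<rightarrow> space M"
  by (simp add: uniform_count_measure_def)

lemma real_distribution_walk_law: "real_distribution (walk_law n)"
  unfolding walk_law_def
  by (intro prob_space.real_distribution_distr prob_space_uniform_count_measure) auto

lemma integrable_uniform_count_measure:
  fixes f :: "'a \<Rightarrow> 'b :: {banach, second_countable_topology}"
  shows "finite A \<Longrightarrow> integrable (uniform_count_measure A) f"
  unfolding uniform_count_measure_def by (rule integrable_point_measure_finite)

lemma integrable_walk_law: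
  fixes h :: "real \<Rightarrow> 'b :: {banach, second_countable_topology}"
  assumes [measurable]: "h \<in> borel_measurable borel"
  shows "integrable (walk_law n) h"
  unfolding walk_law_def by (subst integrable_distr_eq) (auto intro: integrable_uniform_count_measure)

lemma integral_walk_law:
  fixes h :: "real \<Rightarrow> 'b :: {banach, second_countable_topology}"
  assumes [measurable]: "h \<in> borel_measurable borel"
  shows "integral\<^sup>L (walk_law n) h = (\<Sum>xs\<in>spins n. h (sum_list xs / sqrt (real n))) /\<^sub>R 2 ^ n"
  unfolding walk_law_def
  by (subst integral_distr)
     (auto simp: uniform_count_measure_def lebesgue_integral_point_measure_finite card_spins
        scaleR_sum_right divide_inverse)

lemma integral_walk_law_real:
  fixes h :: "real \<Rightarrow> real"
  assumes "h \<in> borel_measurable borel"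
  shows "integral\<^sup>L (walk_law n) h = (\<Sum>xs\<in>spins n. h (sum_list xs / sqrt (real n))) / 2 ^ n"
  unfolding integral_walk_law[OF assms] real_scaleR_def by (simp only: divide_inverse mult.commute)

lemma integral_walk_law_exp:
  "(\<integral>x. exp (c * x) \<partial>walk_law n) = cosh (c / sqrt (real n)) ^ n" for c :: real
proof -
  have "(\<integral>x. exp (c * x) \<partial>walk_law n) = (\<Sum>xs\<in>spins n. exp (c / sqrt n * sum_list xs)) / 2 ^ n"
    by (subst integral_walk_law_real) auto
  also have "\<dots> = cosh (c / sqrt (real n)) ^ n"
    using sum_spins_exp[where c = "c / sqrt n" and n = n] by (simp add: power_mult_distrib)
  finally show ?thesis .
qed

lemma char_walk_law: "char (walk_law n) t = of_real (cos (t / sqrt (real n)) ^ n)"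
proof -
  define c where "c = \<i> * of_real (t / sqrt (real n))"
  have "char (walk_law n) t = (\<Sum>xs\<in>spins n. exp (c * of_real (sum_list xs))) /\<^sub>R 2 ^ n"
    unfolding char_def c_def by (subst integral_walk_law) (auto simp: mult_ac)
  also have "\<dots> = cosh c ^ n"
    by (simp add: sum_spins_exp power_mult_distrib scaleR_conv_of_real)
  also have "cosh c = of_real (cos (t / sqrt (real n)))"
    unfolding c_def cos_conv_cosh[symmetric] by (simp only: cos_of_real)
  finally show ?thesis by simp
qed

text \<open>The central limit theorem for fair signs, by Levy's continuity theorem and the limit of
  the powers of cos.\<close>

lemma weak_conv_walk_law: "weak_conv_m walk_law std_normal_distribution"
proof (rule levy_continuity)
  fix t :: real
  show "(\<lambda>n. char (walk_law n) t) \<longlonglongrightarrow> char std_normal_distribution t"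
    unfolding char_walk_law char_std_normal_distribution
    by (intro tendsto_of_real cos_scaled_power_limit)
qed (auto intro: real_distribution_walk_law real_dist_normal_dist)

section \<open>Exponential moments of Gaussians and of the magnetisation\<close>

text \<open>Completing the square: tilting the standard normal density by \<open>exp (s * g)\<close>
  shifts its mean to \<open>s\<close> and leaves the factor \<open>exp (s^2 / 2)\<close>.\<close>

lemma has_bochner_integral_std_normal_exp:
  "has_bochner_integral std_normal_distribution (\<lambda>g. exp (s * g)) (exp (s\<^sup>2 / 2))" for s :: real
proof -
  have "has_bochner_integral lborel (\<lambda>g. exp (s\<^sup>2 / 2) * normal_density s 1 g) (exp (s\<^sup>2 / 2) * 1)"
    by (intro has_bochner_integral_mult_right) (auto simp: has_bochner_integral_iff)
  moreover have "exp (s\<^sup>2 / 2) * normal_density s 1 g = std_normal_density g * exp (s * g)" for g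
    by (simp add: normal_density_def exp_add[symmetric] power2_eq_square field_simps)
  ultimately show ?thesis
    by (subst has_bochner_integral_density) auto
qed

lemma integrable_std_normal_exp_square:
  fixes l :: real
  assumes "l < 1"
  shows "integrable std_normal_distribution (\<lambda>g. exp (l * g\<^sup>2 / 2))"
proof -
  \<comment> \<open>The tilted density is proportional to a centred normal density of variance
    \<open>1 / (1 - l)\<close>.\<close>
  define s where "s = 1 / sqrt (1 - l)"
  have s: "s > 0" "s\<^sup>2 = 1 / (1 - l)"
    using assms by (auto simp: s_def power_divide)
  have "integrable lborel (\<lambda>g. s * normal_density 0 s g)"
    using s by (intro integrable_mult_right) auto
  moreover have "s * normal_density 0 s g = std_normal_density g * exp (l * g\<^sup>2 / 2)" for g
  proof -
    have "s * normal_density 0 s g = exp (- (g\<^sup>2 / (2 * s\<^sup>2))) / sqrt (2 * pi)"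
      using s(1) by (simp add: normal_density_def real_sqrt_mult)
    also have "g\<^sup>2 / (2 * s\<^sup>2) = g\<^sup>2 / 2 - l * g\<^sup>2 / 2"
      using assms by (simp add: s(2) field_simps)
    finally show ?thesis
      by (simp add: std_normal_density_def flip: exp_add)
  qed
  ultimately show ?thesis
    by (subst integrable_density) auto
qed

text \<open>The Hubbard-Stratonovich transform: \<open>exp (l x\<^sup>2 / 2)\<close> is a Gaussian average of
  exponentials, whose expectations are powers of \<open>cosh\<close>.\<close>
lemma tendsto_integral_walk_law_exp_square:
  fixes l :: real
  assumes "0 \<le> l" "l < 1"
  shows "(\<lambda>n. \<integral>x. exp (l * x\<^sup>2 / 2) \<partial>walk_law n)
    \<longlonglongrightarrow> (\<integral>g. exp (l * g\<^sup>2 / 2) \<partial>std_normal_distribution)"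
proof -
  let ?\<gamma> = "std_normal_distribution"
  \<comment> \<open>The Gaussian moment formula at \<open>sqrt l * x\<close>, read from right to
    left, linearises the square in the exponent.\<close>
  have hs: "(\<integral>g. exp (sqrt l * x * g) \<partial>?\<gamma>) = exp (l * x\<^sup>2 / 2)"
    "integrable ?\<gamma> (\<lambda>g. exp (sqrt l * x * g))" for x
    using has_bochner_integral_std_normal_exp[of "sqrt l * x"] assms
    by (auto simp: has_bochner_integral_iff power_mult_distrib)
  have "(\<integral>x. exp (l * x\<^sup>2 / 2) \<partial>walk_law n) = (\<integral>g. cosh (sqrt l * g / sqrt n) ^ n \<partial>?\<gamma>)" for n
  proof -
    have "(\<integral>x. exp (l * x\<^sup>2 / 2) \<partial>walk_law n)
        = (\<Sum>xs\<in>spins n. \<integral>g. exp (sqrt l * (sum_list xs / sqrt n) * g) \<partial>?\<gamma>) / 2 ^ n"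
      unfolding hs(1) by (subst integral_walk_law_real) auto
    \<comment> \<open>The Gaussian integral is interchanged with the finite sum over the
      spins.\<close>
    also have "\<dots> = (\<integral>g. (\<Sum>xs\<in>spins n. exp (sqrt l * (sum_list xs / sqrt n) * g)) / 2 ^ n \<partial>?\<gamma>)"
      by (simp add: hs(2) Bochner_Integration.integral_sum del: times_divide_eq_right)
    also have "(\<lambda>g. (\<Sum>xs\<in>spins n. exp (sqrt l * (sum_list xs / sqrt n) * g)) / 2 ^ n)
        = (\<lambda>g. \<integral>x. exp (sqrt l * g * x) \<partial>walk_law n)"
      by (subst integral_walk_law_real) (auto simp: mult_ac)
    finally show ?thesis
      by (simp add: integral_walk_law_exp)
  qed
  moreover have "(\<lambda>n. \<integral>g. cosh (sqrt l * g / sqrt n) ^ n \<partial>?\<gamma>)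
    \<longlonglongrightarrow> (\<integral>g. exp (l * g\<^sup>2 / 2) \<partial>?\<gamma>)"
  proof (rule integral_dominated_convergence)
    show "integrable ?\<gamma> (\<lambda>g. exp (l * g\<^sup>2 / 2))"
      using assms by (intro integrable_std_normal_exp_square)
    show "AE g in ?\<gamma>. (\<lambda>n. cosh (sqrt l * g / sqrt (real n)) ^ n) \<longlonglongrightarrow> exp (l * g\<^sup>2 / 2)"
    proof (rule AE_I2)
      fix g
      show "(\<lambda>n. cosh (sqrt l * g / sqrt (real n)) ^ n) \<longlonglongrightarrow> exp (l * g\<^sup>2 / 2)"
        using cosh_scaled_power_limit[of "sqrt l * g"] assms by (simp add: power_mult_distrib)
    qed
    show "AE g in ?\<gamma>. norm (cosh (sqrt l * g / sqrt (real n)) ^ n) \<le> exp (l * g\<^sup>2 / 2)" for n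
    proof (rule AE_I2)
      fix g
      have "cosh (sqrt l * g / sqrt (real n)) ^ n \<le> exp ((sqrt l * g / sqrt (real n))\<^sup>2 / 2) ^ n"
        by (intro power_mono cosh_le_exp_half_square) auto
      also have "\<dots> = exp (real n * ((sqrt l * g / sqrt (real n))\<^sup>2 / 2))"
        by (rule exp_of_nat_mult[symmetric])
      \<comment> \<open>Equality for positive \<open>n\<close>; for \<open>n = 0\<close> the left
        side is 1 and \<open>0 \<le> l\<close> is used.\<close>
      also have "\<dots> \<le> exp (l * g\<^sup>2 / 2)"
        using assms by (cases "n = 0") (auto simp: power_mult_distrib power_divide)
      finally show "norm (cosh (sqrt l * g / sqrt (real n)) ^ n) \<le> exp (l * g\<^sup>2 / 2)"
        by simp
    qed
    show "(\<lambda>g. cosh (sqrt l * g / sqrt (real n)) ^ n) \<in> borel_measurable ?\<gamma>" for n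
      unfolding cosh_field_def by measurable
  qed measurable
  ultimately show ?thesis by simp
qed

section \<open>Convergence of integrals over product measures\<close>

lemma integrable_pair_measure_mult:
  fixes f :: "'a \<Rightarrow> real" and g :: "'b \<Rightarrow> real"
  assumes "pair_sigma_finite M1 M2" and f: "integrable M1 f" and g: "integrable M2 g"
  shows "integrable (M1 \<Otimes>\<^sub>M M2) (\<lambda>z. f (fst z) * g (snd z))"
proof -
  interpret pair_sigma_finite M1 M2 by fact
  have [measurable]: "f \<in> borel_measurable M1" "g \<in> borel_measurable M2"
    using f g by auto
  show ?thesis
    using f g by (intro Fubini_integrable) (auto simp: abs_mult intro!: integrable_abs)
qed

lemma integral_pair_measure_mult:
  fixes f :: "'a \<Rightarrow> real" and g :: "'b \<Rightarrow> real"
  assumes "pair_sigma_finite M1 M2" "integrable M1 f" "integrable M2 g"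
  shows "(\<integral>z. f (fst z) * g (snd z) \<partial>(M1 \<Otimes>\<^sub>M M2)) = integral\<^sup>L M1 f * integral\<^sup>L M2 g"
  using pair_sigma_finite.integral_fst'[OF assms(1) integrable_pair_measure_mult[OF assms]] by simp

text \<open>Skorohod representations of the two coordinates on separate probability spaces give, on the
  product space, pointwise convergence of the pairs.\<close>
lemma tendsto_integral_pair_measure:
  fixes F :: "nat \<Rightarrow> real \<times> real \<Rightarrow> real" and \<phi> \<psi> :: "real \<Rightarrow> real"
  assumes \<mu>: "\<And>n. real_distribution (\<mu> n)" "real_distribution \<mu>'" "weak_conv_m \<mu> \<mu>'"
    and \<nu>: "\<And>n. real_distribution (\<nu> n)" "real_distribution \<nu>'" "weak_conv_m \<nu> \<nu>'"
    and F_meas: "\<And>n. F n \<in> borel_measurable borel" and f_meas: "f \<in> borel_measurable borel"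
    and F_lim: "\<And>p p'. p \<longlonglongrightarrow> p' \<Longrightarrow> (\<lambda>n. F n (p n)) \<longlonglongrightarrow> f p'"
    and bound: "\<forall>\<^sub>F n in sequentially. \<forall>x y. \<bar>F n (x, y)\<bar> \<le> \<phi> x * \<psi> y"
    and \<phi>: "continuous_on UNIV \<phi>" "\<And>x. 0 \<le> \<phi> x" "\<And>n. integrable (\<mu> n) \<phi>" "integrable \<mu>' \<phi>"
      "(\<lambda>n. integral\<^sup>L (\<mu> n) \<phi>) \<longlonglongrightarrow> integral\<^sup>L \<mu>' \<phi>"
    and \<psi>: "continuous_on UNIV \<psi>" "\<And>x. 0 \<le> \<psi> x" "\<And>n. integrable (\<nu> n) \<psi>" "integrable \<nu>' \<psi>"
      "(\<lambda>n. integral\<^sup>L (\<nu> n) \<psi>) \<longlonglongrightarrow> integral\<^sup>L \<nu>' \<psi>"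
  shows "(\<lambda>n. integral\<^sup>L (\<mu> n \<Otimes>\<^sub>M \<nu> n) (F n)) \<longlonglongrightarrow> integral\<^sup>L (\<mu>' \<Otimes>\<^sub>M \<nu>') f"
proof -
  obtain \<Omega>1 :: "real measure" and U U' where "prob_space \<Omega>1"
    and U [measurable]: "\<And>n. U n \<in> borel_measurable \<Omega>1" "U' \<in> borel_measurable \<Omega>1"
    and dU: "\<And>n. distr \<Omega>1 borel (U n) = \<mu> n" "distr \<Omega>1 borel U' = \<mu>'"
    and limU: "\<And>x. x \<in> space \<Omega>1 \<Longrightarrow> (\<lambda>n. U n x) \<longlonglongrightarrow> U' x"
    using Skorohod[OF \<mu>] by force
  obtain \<Omega>2 :: "real measure" and V V' where "prob_space \<Omega>2"
    and V [measurable]: "\<And>n. V n \<in> borel_measurable \<Omega>2" "V' \<in> borel_measurable \<Omega>2"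
    and dV: "\<And>n. distr \<Omega>2 borel (V n) = \<nu> n" "distr \<Omega>2 borel V' = \<nu>'"
    and limV: "\<And>x. x \<in> space \<Omega>2 \<Longrightarrow> (\<lambda>n. V n x) \<longlonglongrightarrow> V' x"
    using Skorohod[OF \<nu>] by force
  interpret \<Omega>1: prob_space \<Omega>1 by fact
  interpret \<Omega>2: prob_space \<Omega>2 by fact
  interpret pair_prob_space \<Omega>1 \<Omega>2 ..
  have [measurable]: "\<phi> \<in> borel_measurable borel" "\<psi> \<in> borel_measurable borel"
    using \<phi>(1) \<psi>(1) by (auto intro: borel_measurable_continuous_onI)
  note [measurable] = F_meas f_meas
  \<comment> \<open>The product of the image measures is the image of the product measure, so all
    integrals move to one fixed space.\<close>
  have pair: "integral\<^sup>L (distr \<Omega>1 borel X \<Otimes>\<^sub>M distr \<Omega>2 borel Y) h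
      = (\<integral>z. h (X (fst z), Y (snd z)) \<partial>(\<Omega>1 \<Otimes>\<^sub>M \<Omega>2))"
    if [measurable]: "X \<in> borel_measurable \<Omega>1" "Y \<in> borel_measurable \<Omega>2" "h \<in> borel_measurable borel"
    for X Y :: "real \<Rightarrow> real" and h :: "real \<times> real \<Rightarrow> real"
  proof -
    have "sigma_finite_measure (distr \<Omega>2 borel Y)"
      by (intro prob_space_imp_sigma_finite \<Omega>2.prob_space_distr) simp
    then have "distr \<Omega>1 borel X \<Otimes>\<^sub>M distr \<Omega>2 borel Y
        = distr (\<Omega>1 \<Otimes>\<^sub>M \<Omega>2) (borel \<Otimes>\<^sub>M borel) (\<lambda>(x, y). (X x, Y y))"
      by (intro pair_measure_distr) auto
    then show ?thesis
      by (simp add: integral_distr split_beta' borel_prod)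
  qed
  have E1: "integrable \<Omega>1 (\<lambda>x. \<phi> (U n x))" "(\<integral>x. \<phi> (U n x) \<partial>\<Omega>1) = integral\<^sup>L (\<mu> n) \<phi>" for n
    using \<phi>(3)[of n] by (auto simp: dU(1)[symmetric] integrable_distr_eq integral_distr)
  have E1': "integrable \<Omega>1 (\<lambda>x. \<phi> (U' x))" "(\<integral>x. \<phi> (U' x) \<partial>\<Omega>1) = integral\<^sup>L \<mu>' \<phi>"
    using \<phi>(4) by (auto simp: dU(2)[symmetric] integrable_distr_eq integral_distr)
  have E2: "integrable \<Omega>2 (\<lambda>x. \<psi> (V n x))" "(\<integral>x. \<psi> (V n x) \<partial>\<Omega>2) = integral\<^sup>L (\<nu> n) \<psi>" for n
    using \<psi>(3)[of n] by (auto simp: dV(1)[symmetric] integrable_distr_eq integral_distr)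
  have E2': "integrable \<Omega>2 (\<lambda>x. \<psi> (V' x))" "(\<integral>x. \<psi> (V' x) \<partial>\<Omega>2) = integral\<^sup>L \<nu>' \<psi>"
    using \<psi>(4) by (auto simp: dV(2)[symmetric] integrable_distr_eq integral_distr)
  have "(\<lambda>n. \<integral>z. F n (U n (fst z), V n (snd z)) \<partial>(\<Omega>1 \<Otimes>\<^sub>M \<Omega>2))
      \<longlonglongrightarrow> (\<integral>z. f (U' (fst z), V' (snd z)) \<partial>(\<Omega>1 \<Otimes>\<^sub>M \<Omega>2))"
  \<comment> \<open>The majorants vary with \<open>n\<close>, but as products over independent
    coordinates their integrals factor and converge by the assumptions on \<open>\<phi>\<close> and
    \<open>\<psi>\<close>.\<close>
  proof (rule tendsto_integral_dominated_by_convergent[where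
        G = "\<lambda>n z. \<phi> (U n (fst z)) * \<psi> (V n (snd z))" and
        g = "\<lambda>z. \<phi> (U' (fst z)) * \<psi> (V' (snd z))"])
    show "AE z in \<Omega>1 \<Otimes>\<^sub>M \<Omega>2. (\<lambda>n. F n (U n (fst z), V n (snd z))) \<longlonglongrightarrow> f (U' (fst z), V' (snd z))"
      by (auto simp: space_pair_measure intro!: F_lim tendsto_Pair limU limV)
    have "isCont \<phi> x" "isCont \<psi> x" for x
      using \<phi>(1) \<psi>(1) by (auto simp: continuous_on_eq_continuous_at)
    then show "AE z in \<Omega>1 \<Otimes>\<^sub>M \<Omega>2. (\<lambda>n. \<phi> (U n (fst z)) * \<psi> (V n (snd z)))
        \<longlonglongrightarrow> \<phi> (U' (fst z)) * \<psi> (V' (snd z))"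
      by (auto simp: space_pair_measure
          intro!: tendsto_mult isCont_tendsto_compose[of _ \<phi>] isCont_tendsto_compose[of _ \<psi>] limU limV)
    have ps: "pair_sigma_finite \<Omega>1 \<Omega>2" ..
    show "integrable (\<Omega>1 \<Otimes>\<^sub>M \<Omega>2) (\<lambda>z. \<phi> (U n (fst z)) * \<psi> (V n (snd z)))" for n
      by (rule integrable_pair_measure_mult[OF ps E1(1) E2(1)])
    show "integrable (\<Omega>1 \<Otimes>\<^sub>M \<Omega>2) (\<lambda>z. \<phi> (U' (fst z)) * \<psi> (V' (snd z)))"
      by (rule integrable_pair_measure_mult[OF ps E1'(1) E2'(1)])
    show "(\<lambda>n. \<integral>z. \<phi> (U n (fst z)) * \<psi> (V n (snd z)) \<partial>(\<Omega>1 \<Otimes>\<^sub>M \<Omega>2))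
        \<longlonglongrightarrow> (\<integral>z. \<phi> (U' (fst z)) * \<psi> (V' (snd z)) \<partial>(\<Omega>1 \<Otimes>\<^sub>M \<Omega>2))"
      unfolding integral_pair_measure_mult[OF ps E1(1) E2(1)]
        integral_pair_measure_mult[OF ps E1'(1) E2'(1)] E1(2) E2(2) E1'(2) E2'(2)
      by (intro tendsto_mult \<phi> \<psi>)
    show "\<forall>\<^sub>F n in sequentially. \<forall>z\<in>space (\<Omega>1 \<Otimes>\<^sub>M \<Omega>2).
        \<bar>F n (U n (fst z), V n (snd z))\<bar> \<le> \<phi> (U n (fst z)) * \<psi> (V n (snd z))"
      using bound by eventually_elim auto
  qed (use \<phi>(2) \<psi>(2) in \<open>auto simp: borel_prod\<close>)
  then show ?thesis
    by (simp add: pair flip: dU dV)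
qed

section \<open>The Curie-Weiss law as a reweighted product measure\<close>

lemma integral_pair_walk_law:
  fixes h :: "real \<times> real \<Rightarrow> real"
  assumes [measurable]: "h \<in> borel_measurable borel"
  shows "integral\<^sup>L (walk_law m \<Otimes>\<^sub>M walk_law n) h
    = (\<Sum>z\<in>spins m \<times> spins n. h (sum_list (fst z) / sqrt (real m), sum_list (snd z) / sqrt (real n)))
      / (2 ^ m * 2 ^ n)"
proof -
  let ?M = "uniform_count_measure (spins m)" and ?N = "uniform_count_measure (spins n)"
  have N: "prob_space ?N" "prob_space ?M"
    by (auto intro: prob_space_uniform_count_measure)
  interpret M: prob_space ?M by fact
  interpret N: prob_space ?N by fact
  interpret pair_prob_space ?M ?N ..
  \<comment> \<open>A product of uniform measures gives every pair of configurations the same mass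
    \<open>1 / (2 ^ m * 2 ^ n)\<close>.\<close>
  have eq: "?M \<Otimes>\<^sub>M ?N = point_measure (spins m \<times> spins n) (\<lambda>_. ennreal (1 / (2 ^ m * 2 ^ n)))"
  proof -
    have "?M \<Otimes>\<^sub>M ?N = density (count_space (spins m) \<Otimes>\<^sub>M count_space (spins n))
        (\<lambda>(x, y). ennreal (1 / card (spins m)) * ennreal (1 / card (spins n)))"
      unfolding uniform_count_measure_def point_measure_def
      by (rule pair_measure_density)
         (auto intro!: sigma_finite_measure_count_space_finite
           N.sigma_finite_measure_axioms[unfolded uniform_count_measure_def point_measure_def])
    also have "\<dots> = point_measure (spins m \<times> spins n) (\<lambda>_. ennreal (1 / (2 ^ m * 2 ^ n)))"
      by (simp add: pair_measure_count_space point_measure_def card_spins split_beta' ennreal_mult'[symmetric])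
    finally show ?thesis .
  qed
  have "walk_law m \<Otimes>\<^sub>M walk_law n = distr (?M \<Otimes>\<^sub>M ?N) (borel \<Otimes>\<^sub>M borel)
      (\<lambda>(x, y). (sum_list x / sqrt (real m), sum_list y / sqrt (real n)))"
    unfolding walk_law_def
    by (rule pair_measure_distr)
       (auto intro!: prob_space_imp_sigma_finite N.prob_space_distr)
  also have "integral\<^sup>L \<dots> h
    = (\<integral>z. h (sum_list (fst z) / sqrt (real m), sum_list (snd z) / sqrt (real n)) \<partial>(?M \<Otimes>\<^sub>M ?N))"
    by (subst integral_distr) (auto simp: borel_prod split_beta' eq)
  finally show ?thesis
    by (simp add: eq lebesgue_integral_point_measure_finite sum_divide_distrib)
qed

text \<open>The exponential of half the quadratic form with matrix rows \<open>(a, b)\<close> and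
  \<open>(b, c)\<close>; it serves both for the Gibbs weight at finite \<open>N\<close> and for its
  limit.\<close>

definition quad_weight :: "real \<Rightarrow> real \<Rightarrow> real \<Rightarrow> real \<times> real \<Rightarrow> real" where
  "quad_weight a b c p = exp ((a * (fst p)\<^sup>2 + 2 * b * fst p * snd p + c * (snd p)\<^sup>2) / 2)"

lemma quad_weight_nonneg [simp]: "0 \<le> quad_weight a b c p"
  by (simp add: quad_weight_def)

lemma borel_measurable_quad_weight [measurable]: "quad_weight a b c \<in> borel_measurable borel"
  unfolding quad_weight_def by (simp flip: borel_prod)

text \<open>Writing the group sums as \<open>sqrt m * u\<close> and \<open>sqrt n * v\<close> turns
  the Gibbs exponent into a quadratic form in \<open>(u, v)\<close>. The uniform masses cancel
  between numerator and partition function.\<close>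

lemma integral_cw_fluct_law:
  fixes f :: "real \<times> real \<Rightarrow> real"
  assumes f: "f \<in> borel_measurable borel" and pos: "0 < m" "0 < n"
  defines "w \<equiv> \<lambda>N J1 J2 Jb. quad_weight (J1 * (real m / real N))
      (Jb * sqrt (real m / real N * (real n / real N))) (J2 * (real n / real N))"
  shows "integral\<^sup>L (cw_fluct_law N m n J1 J2 Jb) f
    = (\<integral>p. f p * w N J1 J2 Jb p \<partial>(walk_law m \<Otimes>\<^sub>M walk_law n))
      / integral\<^sup>L (walk_law m \<Otimes>\<^sub>M walk_law n) (w N J1 J2 Jb)"
proof -
  let ?S = "spins m \<times> spins n"
  let ?Z = "cw_Z N m n J1 J2 Jb"
  define g :: "real list \<times> real list \<Rightarrow> real \<times> real" where
    "g z = (sum_list (fst z) / sqrt (real m), sum_list (snd z) / sqrt (real n))" for z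
  let ?w = "w N J1 J2 Jb"
  have w: "?w (g z) = cw_weight N J1 J2 Jb z" for z
  \<comment> \<open>For \<open>N = 0\<close> both exponents vanish, division by zero being
    zero.\<close>
  proof (cases "N = 0")
    case False
    have s: "sqrt (real m / real N * (real n / real N)) = sqrt (real m) * sqrt (real n) / real N"
      by (simp add: real_sqrt_mult real_sqrt_divide)
    show ?thesis
      unfolding w_def s using pos False
      by (simp add: quad_weight_def g_def cw_weight_def power_divide) (simp add: field_simps)
  qed (simp add: w_def quad_weight_def cw_weight_def)
  have [measurable]: "?w \<in> borel_measurable borel"
    unfolding w_def by measurable
  note [measurable] = f
  have Z: "?Z > 0"
    unfolding cw_Z_def by (intro sum_pos) (auto simp: cw_weight_def)
  have "integral\<^sup>L (cw_fluct_law N m n J1 J2 Jb) f = (\<integral>z. f (g z) \<partial>cw_law N m n J1 J2 Jb)"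
    unfolding cw_fluct_law_def g_def by (subst integral_distr) (auto simp: cw_law_def)
  also have "\<dots> = (\<Sum>z\<in>?S. cw_weight N J1 J2 Jb z / ?Z * f (g z))"
    unfolding cw_law_def using Z
    by (subst integral_density)
       (auto simp: lebesgue_integral_count_space_finite cw_weight_def sum_divide_distrib)
  also have "\<dots> = (\<Sum>z\<in>?S. f (g z) * ?w (g z)) / (\<Sum>z\<in>?S. ?w (g z))"
    by (simp add: w cw_Z_def sum_divide_distrib mult.commute)
  also have "\<dots> = (\<integral>p. f p * ?w p \<partial>(walk_law m \<Otimes>\<^sub>M walk_law n)) / integral\<^sup>L (walk_law m \<Otimes>\<^sub>M walk_law n) ?w"
    by (simp add: integral_pair_walk_law g_def)
  finally show ?thesis .
qed

section \<open>The tilted Gaussian and its normalisation\<close>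

lemma borel_measurable_std_normal_pair_density [measurable]:
  "(\<lambda>p. std_normal_density (fst p) * std_normal_density (snd p)) \<in> borel_measurable borel"
  by (simp flip: borel_prod)

lemma std_normal_pair_measure:
  "std_normal_distribution \<Otimes>\<^sub>M std_normal_distribution
    = density lborel (\<lambda>p. ennreal (std_normal_density (fst p) * std_normal_density (snd p)))"
proof -
  have "sigma_finite_measure std_normal_distribution"
    by (intro prob_space_imp_sigma_finite prob_space_normal_density) simp
  then have "std_normal_distribution \<Otimes>\<^sub>M std_normal_distribution
      = density (lborel \<Otimes>\<^sub>M lborel) (\<lambda>(x, y). ennreal (std_normal_density x) * ennreal (std_normal_density y))"
    by (intro pair_measure_density) (auto intro: sigma_finite_lborel)
  then show ?thesis
    by (simp add: lborel_prod split_beta' ennreal_mult')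
qed

text \<open>Completing the square in \<open>y\<close> splits the tilted density into a normal
  density in \<open>y\<close> given \<open>x\<close>, with mean \<open>b * x / r\<close> and
  variance \<open>1 / r\<close>, and a centred normal density in \<open>x\<close> of variance
  \<open>r / d\<close>. Both integrate to 1, leaving the constant \<open>1 / sqrt d\<close>.\<close>

lemma has_bochner_integral_std_normal_quad_weight:
  fixes a b c :: real
  assumes c: "c < 1" and D: "0 < (1 - a) * (1 - c) - b\<^sup>2"
  shows "has_bochner_integral (std_normal_distribution \<Otimes>\<^sub>M std_normal_distribution)
    (quad_weight a b c) (1 / sqrt ((1 - a) * (1 - c) - b\<^sup>2))"
proof (rule has_bochner_integral_nn_integral)
  define r where "r = 1 - c"
  define d where "d = (1 - a) * (1 - c) - b\<^sup>2"
  have pos: "0 < r" "0 < d"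
    using c D by (auto simp: r_def d_def)
  let ?\<sigma> = "sqrt r / sqrt d"
  have split: "std_normal_density x * std_normal_density y * quad_weight a b c (x, y)
      = (1 / sqrt d * normal_density 0 ?\<sigma> x) * normal_density (b * x / r) (1 / sqrt r) y" for x y
  proof -
    have "std_normal_density x * std_normal_density y * quad_weight a b c (x, y)
        = exp (- x\<^sup>2 / 2 + - y\<^sup>2 / 2 + (a * x\<^sup>2 + 2 * b * x * y + c * y\<^sup>2) / 2) / (2 * pi)"
      by (simp add: std_normal_density_def quad_weight_def exp_add[symmetric] exp_diff[symmetric])
    also have "- x\<^sup>2 / 2 + - y\<^sup>2 / 2 + (a * x\<^sup>2 + 2 * b * x * y + c * y\<^sup>2) / 2
        = - x\<^sup>2 / (2 * (r / d)) + - (y - b * x / r)\<^sup>2 / (2 * (1 / r))"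
    proof -
      \<comment> \<open>Expressing \<open>a\<close> and \<open>c\<close> through \<open>r\<close>
        and \<open>d\<close> leaves only these two positive quantities as denominators.\<close>
      have a: "a = 1 - (d + b\<^sup>2) / r" and c': "c = 1 - r"
        using pos by (auto simp: r_def d_def field_simps)
      show ?thesis
        unfolding a c' using pos by (simp add: power2_eq_square field_simps)
    qed
    also have "2 * pi = sqrt (2 * pi) * sqrt (2 * pi)"
      by simp
    also have "exp (- x\<^sup>2 / (2 * (r / d)) + - (y - b * x / r)\<^sup>2 / (2 * (1 / r))) / \<dots>
        = (1 / sqrt d * normal_density 0 ?\<sigma> x) * normal_density (b * x / r) (1 / sqrt r) y"
      using pos by (simp add: normal_density_def power_divide real_sqrt_mult real_sqrt_divide
          exp_add[symmetric] exp_diff[symmetric] del: real_sqrt_mult_self)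
    finally show ?thesis .
  qed
  have "(\<integral>\<^sup>+ p. ennreal (quad_weight a b c p) \<partial>(std_normal_distribution \<Otimes>\<^sub>M std_normal_distribution))
      = (\<integral>\<^sup>+ p. ennreal (std_normal_density (fst p) * std_normal_density (snd p) * quad_weight a b c p)
          \<partial>(lborel \<Otimes>\<^sub>M lborel))"
    unfolding std_normal_pair_measure
    by (subst nn_integral_density) (auto simp: lborel_prod ennreal_mult'[symmetric])
  also have "\<dots> = (\<integral>\<^sup>+ x. \<integral>\<^sup>+ y. ennreal (1 / sqrt d * normal_density 0 ?\<sigma> x)
      * ennreal (normal_density (b * x / r) (1 / sqrt r) y) \<partial>lborel \<partial>lborel)"
    using pos by (subst lborel.nn_integral_fst[symmetric])
       (auto simp: split ennreal_mult'[symmetric] borel_prod lborel_prod intro!: nn_integral_cong)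
  also have "\<dots> = (\<integral>\<^sup>+ x. ennreal (1 / sqrt d) * ennreal (normal_density 0 ?\<sigma> x) \<partial>lborel)"
  proof (rule nn_integral_cong)
    fix x
    have "(\<integral>\<^sup>+ y. ennreal (normal_density (b * x / r) (1 / sqrt r) y) \<partial>lborel) = 1"
      using pos by (subst nn_integral_eq_integral) auto
    then show "(\<integral>\<^sup>+ y. ennreal (1 / sqrt d * normal_density 0 ?\<sigma> x)
      * ennreal (normal_density (b * x / r) (1 / sqrt r) y) \<partial>lborel)
      = ennreal (1 / sqrt d) * ennreal (normal_density 0 ?\<sigma> x)"
      using pos by (subst nn_integral_cmult) (auto simp: ennreal_mult'[symmetric])
  qed
  also have "\<dots> = ennreal (1 / sqrt d)"
  proof -
    have "(\<integral>\<^sup>+ x. ennreal (normal_density 0 ?\<sigma> x) \<partial>lborel) = 1"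
      using pos by (subst nn_integral_eq_integral) auto
    then show ?thesis by (simp add: nn_integral_cmult)
  qed
  finally show "(\<integral>\<^sup>+ p. ennreal (quad_weight a b c p) \<partial>(std_normal_distribution \<Otimes>\<^sub>M std_normal_distribution))
      = ennreal (1 / sqrt ((1 - a) * (1 - c) - b\<^sup>2))"
    by (simp add: d_def)
  show "AE p in std_normal_distribution \<Otimes>\<^sub>M std_normal_distribution. 0 \<le> quad_weight a b c p"
    by simp
  show "quad_weight a b c \<in> borel_measurable (std_normal_distribution \<Otimes>\<^sub>M std_normal_distribution)"
    unfolding std_normal_pair_measure by simp
qed (use D in simp)

text \<open>The tilt changes the inverse covariance from the identity to the matrix with rows
  \<open>(1 - a, - b)\<close> and \<open>(- b, 1 - c)\<close>. Its determinant is \<open>d\<close>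
  and its inverse is the covariance here, so \<open>sqrt d\<close> is the normalising
  factor.\<close>

lemma integral_normal2:
  fixes a b c :: real and f :: "real \<times> real \<Rightarrow> real"
  assumes [measurable]: "f \<in> borel_measurable borel"
  defines "d \<equiv> (1 - a) * (1 - c) - b\<^sup>2"
  assumes d: "0 < d"
  shows "integral\<^sup>L (normal2 ((1 - c) / d) (b / d) ((1 - a) / d)) f
    = sqrt d * (\<integral>p. f p * quad_weight a b c p \<partial>(std_normal_distribution \<Otimes>\<^sub>M std_normal_distribution))"
proof -
  have det: "(1 - c) / d * ((1 - a) / d) - (b / d)\<^sup>2 = 1 / d"
  proof -
    have "(1 - c) / d * ((1 - a) / d) - (b / d)\<^sup>2 = ((1 - a) * (1 - c) - b\<^sup>2) / d\<^sup>2"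
      by (simp add: power_divide power2_eq_square[of d]) (simp only: diff_divide_distrib mult.commute)
    also have "(1 - a) * (1 - c) - b\<^sup>2 = d"
      by (simp only: d_def)
    finally show ?thesis
      using d by (simp add: power2_eq_square)
  qed
  have dens: "normal2_density ((1 - c) / d) (b / d) ((1 - a) / d) p
      = sqrt d * (std_normal_density (fst p) * std_normal_density (snd p) * quad_weight a b c p)" for p
  proof -
    obtain x y where p: "p = (x, y)" by (cases p)
    have "normal2_density ((1 - c) / d) (b / d) ((1 - a) / d) p
        = sqrt d * exp (- ((1 - a) * x\<^sup>2 - 2 * b * x * y + (1 - c) * y\<^sup>2) / 2) / (2 * pi)"
    proof -
      have "- ((1 - a) / d * x\<^sup>2 - 2 * (b / d) * x * y + (1 - c) / d * y\<^sup>2) / (2 * (1 / d))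
          = - ((1 - a) * x\<^sup>2 - 2 * b * x * y + (1 - c) * y\<^sup>2) / 2"
        using d by (simp add: field_simps)
      then show ?thesis
        unfolding normal2_density_def Let_def det p using d by (simp add: real_sqrt_divide)
    qed
    also have "- ((1 - a) * x\<^sup>2 - 2 * b * x * y + (1 - c) * y\<^sup>2) / 2
        = - x\<^sup>2 / 2 + - y\<^sup>2 / 2 + (a * x\<^sup>2 + 2 * b * x * y + c * y\<^sup>2) / 2"
      by (simp add: field_simps)
    finally show ?thesis
      by (simp add: p std_normal_density_def quad_weight_def exp_add[symmetric] exp_diff[symmetric])
  qed
  have "integral\<^sup>L (normal2 ((1 - c) / d) (b / d) ((1 - a) / d)) f
      = (\<integral>p. sqrt d * (std_normal_density (fst p) * std_normal_density (snd p) * quad_weight a b c p) * f p \<partial>lborel)"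
    unfolding normal2_def dens using d
    by (subst integral_density) (auto intro!: mult_nonneg_nonneg)
  also have "\<dots> = sqrt d * (\<integral>p. std_normal_density (fst p) * std_normal_density (snd p) * (f p * quad_weight a b c p) \<partial>lborel)"
    by (simp add: mult_ac flip: Bochner_Integration.integral_mult_right_zero)
  also have "(\<integral>p. std_normal_density (fst p) * std_normal_density (snd p) * (f p * quad_weight a b c p) \<partial>lborel)
      = (\<integral>p. f p * quad_weight a b c p \<partial>(std_normal_distribution \<Otimes>\<^sub>M std_normal_distribution))"
    unfolding std_normal_pair_measure
    by (subst integral_density) auto
  finally show ?thesis .
qed

section \<open>The high temperature bound and the limit theorem\<close>

text \<open>Multiplying the form by \<open>p\<close> and completing the square gives a sum of two
  nonnegative terms.\<close>

lemma binary_quadratic_form_nonneg: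
  fixes p q s x y :: real
  assumes "0 < p" "q\<^sup>2 \<le> p * s"
  shows "0 \<le> p * x\<^sup>2 - 2 * q * x * y + s * y\<^sup>2"
proof -
  have "0 \<le> (p * x - q * y)\<^sup>2 + (p * s - q\<^sup>2) * y\<^sup>2"
    using assms by (intro add_nonneg_nonneg mult_nonneg_nonneg) auto
  also have "\<dots> = p * (p * x\<^sup>2 - 2 * q * x * y + s * y\<^sup>2)"
    by (simp add: power2_eq_square algebra_simps)
  finally show ?thesis
    using assms(1) by (simp add: zero_le_mult_iff)
qed

theorem theorem2:
  fixes N1 N2 :: "nat \<Rightarrow> nat" and J1 J2 Jb \<alpha>1 \<alpha>2 :: real
  assumes sizes: "\<forall>\<^sub>F N in sequentially. 0 < N1 N \<and> 0 < N2 N \<and> N1 N + N2 N \<le> N"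
    and N1_inf: "filterlim N1 at_top sequentially"
    and N2_inf: "filterlim N2 at_top sequentially"
    and lim1: "(\<lambda>N. real (N1 N) / real N) \<longlonglongrightarrow> \<alpha>1"
    and lim2: "(\<lambda>N. real (N2 N) / real N) \<longlonglongrightarrow> \<alpha>2"
    and J_pos: "J1 > 0" "J2 > 0" "Jb > 0"
    and Delta_pos: "J1 * J2 - Jb\<^sup>2 > 0"
    and alpha_pos: "\<alpha>1 > 0" "\<alpha>2 > 0"
    and high_temp: "J1 < 1 / \<alpha>1" "J2 < 1 / \<alpha>2"
      "Jb\<^sup>2 < (1 / \<alpha>1 - J1) * (1 / \<alpha>2 - J2)"
  shows "weak_conv2 (\<lambda>N. cw_fluct_law N (N1 N) (N2 N) J1 J2 Jb)
           (let D = (1 - \<alpha>1 * J1) * (1 - \<alpha>2 * J2) - \<alpha>1 * \<alpha>2 * Jb\<^sup>2 in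
            normal2 ((1 - \<alpha>2 * J2) / D) (sqrt (\<alpha>1 * \<alpha>2) * Jb / D) ((1 - \<alpha>1 * J1) / D))"
proof -
  let ?\<gamma> = "std_normal_distribution"
  \<comment> \<open>These are the coefficients of the limiting quadratic form; \<open>d\<close>
    becomes the denominator \<open>D\<close> of the claimed covariance.\<close>
  define a where "a = J1 * \<alpha>1"
  define b where "b = Jb * sqrt (\<alpha>1 * \<alpha>2)"
  define c where "c = J2 * \<alpha>2"
  define d where "d = (1 - a) * (1 - c) - b\<^sup>2"
  have a1: "0 < a" "a < 1" and c1: "c < 1"
    using J_pos alpha_pos high_temp by (auto simp: a_def c_def field_simps)
  have b2: "b\<^sup>2 = \<alpha>1 * \<alpha>2 * Jb\<^sup>2"
    using alpha_pos by (simp add: b_def power_mult_distrib)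
  \<comment> \<open>Multiplied by \<open>\<alpha>1 * \<alpha>2\<close>, the third high temperature
    condition becomes \<open>0 < d\<close>.\<close>
  have "\<alpha>1 * \<alpha>2 * Jb\<^sup>2 < \<alpha>1 * \<alpha>2 * ((1 / \<alpha>1 - J1) * (1 / \<alpha>2 - J2))"
    using high_temp(3) alpha_pos by (intro mult_strict_left_mono) auto
  also have "\<dots> = (1 - a) * (1 - c)"
    using alpha_pos by (simp add: a_def c_def field_simps)
  finally have d_pos: "0 < d"
    by (simp add: d_def b2)
  define aN where "aN N = J1 * (real (N1 N) / real N)" for N
  define bN where "bN N = Jb * sqrt (real (N1 N) / real N * (real (N2 N) / real N))" for N
  define cN where "cN N = J2 * (real (N2 N) / real N)" for N
  have lims: "aN \<longlonglongrightarrow> a" "bN \<longlonglongrightarrow> b" "cN \<longlonglongrightarrow> c"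
    unfolding aN_def bN_def cN_def a_def b_def c_def by (intro tendsto_intros lim1 lim2)+
  \<comment> \<open>At \<open>l = 1\<close> the last inequality is \<open>0 < d\<close>, so by
    continuity it survives for some \<open>l\<close> slightly below 1. Requiring \<open>l\<close> to
    exceed both \<open>a\<close> and \<open>c\<close> makes \<open>l\<close> times the identity
    minus the limiting form positive definite, and \<open>0 < a\<close> gives
    \<open>0 < l\<close>.\<close>
  obtain l where l: "0 < l" "l < 1" "a < l" "c < l" "b\<^sup>2 < (l - a) * (l - c)"
  proof -
    have "((\<lambda>l. (l - a) * (l - c)) \<longlongrightarrow> (1 - a) * (1 - c)) (at_left 1)"
      by (intro tendsto_intros)
    then have "\<forall>\<^sub>F l in at_left 1. b\<^sup>2 < (l - a) * (l - c)"
      by (rule order_tendstoD) (use d_pos in \<open>simp add: d_def\<close>)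
    moreover have "\<forall>\<^sub>F l in at_left 1. max a c < l \<and> l < 1"
      using a1 c1 by (auto simp: eventually_at_left_field intro!: exI[of _ "max a c"])
    ultimately have "\<forall>\<^sub>F l in at_left 1. b\<^sup>2 < (l - a) * (l - c) \<and> max a c < l \<and> l < 1"
      by eventually_elim auto
    then obtain l where "b\<^sup>2 < (l - a) * (l - c)" "max a c < l" "l < 1"
      using eventually_happens[of _ "at_left (1 :: real)"] trivial_limit_at_left_real by blast
    then show ?thesis
      using a1 that[of l] by auto
  qed
  \<comment> \<open>Positive definiteness is an open condition, so the same \<open>l\<close> works
    for the coefficients at all large \<open>N\<close>. The bound separates the variables, as the
    product convergence lemma requires.\<close>
  have dom: "\<forall>\<^sub>F N in sequentially. \<forall>x y.
      quad_weight (aN N) (bN N) (cN N) (x, y) \<le> exp (l * x\<^sup>2 / 2) * exp (l * y\<^sup>2 / 2)"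
  proof -
    have "\<forall>\<^sub>F N in sequentially. 0 < (l - aN N) * (l - cN N) - (bN N)\<^sup>2"
      by (rule order_tendstoD(1)[where y = "(l - a) * (l - c) - b\<^sup>2"])
         (use l in \<open>auto intro!: tendsto_intros lims\<close>)
    moreover have "\<forall>\<^sub>F N in sequentially. aN N < l"
      using lims(1) l(3) by (rule order_tendstoD)
    ultimately show ?thesis
    proof eventually_elim
      case (elim N)
      show ?case
      proof (intro allI)
        fix x y
        have "0 \<le> (l - aN N) * x\<^sup>2 - 2 * bN N * x * y + (l - cN N) * y\<^sup>2"
          using elim by (intro binary_quadratic_form_nonneg) auto
        then show "quad_weight (aN N) (bN N) (cN N) (x, y) \<le> exp (l * x\<^sup>2 / 2) * exp (l * y\<^sup>2 / 2)"
          by (simp add: quad_weight_def exp_add[symmetric] algebra_simps)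
      qed
    qed
  qed
  have lim_weighted: "(\<lambda>N. \<integral>p. f p * quad_weight (aN N) (bN N) (cN N) p \<partial>(walk_law (N1 N) \<Otimes>\<^sub>M walk_law (N2 N)))
      \<longlonglongrightarrow> (\<integral>p. f p * quad_weight a b c p \<partial>(?\<gamma> \<Otimes>\<^sub>M ?\<gamma>))"
    if f: "continuous_on UNIV f" "bounded (range f)" for f :: "real \<times> real \<Rightarrow> real"
  proof -
    from f(2) obtain B where B: "\<And>p. \<bar>f p\<bar> \<le> B" "0 < B"
      unfolding bounded_pos by auto
    have [measurable]: "f \<in> borel_measurable borel"
      using f(1) by (rule borel_measurable_continuous_onI)
    \<comment> \<open>Both groups have their own size, so the limits in \<open>n\<close> are
      composed with a size function tending to infinity.\<close>
    have weak: "weak_conv_m (\<lambda>N. walk_law (K N)) ?\<gamma>" if "filterlim K at_top sequentially" for K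
      using weak_conv_walk_law filterlim_compose[OF _ that]
      unfolding weak_conv_m_def weak_conv_def by blast
    have exp_lim: "(\<lambda>N. \<integral>x. exp (l * x\<^sup>2 / 2) \<partial>walk_law (K N)) \<longlonglongrightarrow> (\<integral>x. exp (l * x\<^sup>2 / 2) \<partial>?\<gamma>)"
      if "filterlim K at_top sequentially" for K
      using filterlim_compose[OF tendsto_integral_walk_law_exp_square that, of l] l by auto
    show ?thesis
    proof (rule tendsto_integral_pair_measure[where
          \<phi> = "\<lambda>x. B * exp (l * x\<^sup>2 / 2)" and \<psi> = "\<lambda>x. exp (l * x\<^sup>2 / 2)"])
      show "(\<lambda>N. f (p N) * quad_weight (aN N) (bN N) (cN N) (p N)) \<longlonglongrightarrow> f p' * quad_weight a b c p'"
        if "p \<longlonglongrightarrow> p'" for p p'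
      proof -
        have "isCont f p'"
          using f(1) by (auto simp: continuous_on_eq_continuous_at simp del: split_paired_All)
        then show ?thesis
          unfolding quad_weight_def
          by (intro tendsto_intros lims that isCont_tendsto_compose[of _ f]) auto
      qed
      show "\<forall>\<^sub>F N in sequentially. \<forall>x y. \<bar>f (x, y) * quad_weight (aN N) (bN N) (cN N) (x, y)\<bar>
          \<le> B * exp (l * x\<^sup>2 / 2) * exp (l * y\<^sup>2 / 2)"
        using dom
      proof eventually_elim
        case (elim N)
        show ?case
        proof (intro allI)
          fix x y
          have "\<bar>f (x, y)\<bar> * quad_weight (aN N) (bN N) (cN N) (x, y)
              \<le> B * (exp (l * x\<^sup>2 / 2) * exp (l * y\<^sup>2 / 2))"
            using B elim by (intro mult_mono) (auto simp: quad_weight_def)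
          then show "\<bar>f (x, y) * quad_weight (aN N) (bN N) (cN N) (x, y)\<bar>
              \<le> B * exp (l * x\<^sup>2 / 2) * exp (l * y\<^sup>2 / 2)"
            by (simp add: abs_mult quad_weight_def mult.assoc)
        qed
      qed
    qed (use l B N1_inf N2_inf in \<open>auto intro!: real_distribution_walk_law real_dist_normal_dist weak
        integrable_walk_law integrable_std_normal_exp_square exp_lim tendsto_mult continuous_intros\<close>)
  qed
  have "(\<lambda>N. integral\<^sup>L (cw_fluct_law N (N1 N) (N2 N) J1 J2 Jb) f)
      \<longlonglongrightarrow> integral\<^sup>L (normal2 ((1 - c) / d) (b / d) ((1 - a) / d)) f"
    if f: "continuous_on UNIV f" "bounded (range f)" for f :: "real \<times> real \<Rightarrow> real"
  proof -
    have meas: "f \<in> borel_measurable borel"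
      using f(1) by (rule borel_measurable_continuous_onI)
    let ?I = "\<lambda>h. \<integral>p. h p * quad_weight a b c p \<partial>(?\<gamma> \<Otimes>\<^sub>M ?\<gamma>)"
    \<comment> \<open>The limit of the normalised partition functions; being nonzero, it permits
      passing to the limit in the quotient, with \<open>f\<close> in the numerator and the constant
      1 in the denominator.\<close>
    have Z: "?I (\<lambda>_. 1) = 1 / sqrt d"
      using has_bochner_integral_std_normal_quad_weight[of c a b] c1 d_pos
      by (simp add: has_bochner_integral_iff d_def)
    have "(\<lambda>N. (\<integral>p. f p * quad_weight (aN N) (bN N) (cN N) p \<partial>(walk_law (N1 N) \<Otimes>\<^sub>M walk_law (N2 N)))
        / (\<integral>p. 1 * quad_weight (aN N) (bN N) (cN N) p \<partial>(walk_law (N1 N) \<Otimes>\<^sub>M walk_law (N2 N))))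
        \<longlonglongrightarrow> ?I f / ?I (\<lambda>_. 1)"
      by (intro tendsto_divide lim_weighted f) (use Z d_pos in auto)
    \<comment> \<open>The quotient formula needs nonempty groups, which \<open>sizes\<close>
      provides for all large \<open>N\<close>.\<close>
    moreover have "\<forall>\<^sub>F N in sequentially.
        (\<integral>p. f p * quad_weight (aN N) (bN N) (cN N) p \<partial>(walk_law (N1 N) \<Otimes>\<^sub>M walk_law (N2 N)))
        / (\<integral>p. 1 * quad_weight (aN N) (bN N) (cN N) p \<partial>(walk_law (N1 N) \<Otimes>\<^sub>M walk_law (N2 N)))
        = integral\<^sup>L (cw_fluct_law N (N1 N) (N2 N) J1 J2 Jb) f"
      using sizes by eventually_elim (simp add: integral_cw_fluct_law[OF meas] aN_def bN_def cN_def)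
    ultimately have "(\<lambda>N. integral\<^sup>L (cw_fluct_law N (N1 N) (N2 N) J1 J2 Jb) f) \<longlonglongrightarrow> ?I f / ?I (\<lambda>_. 1)"
      by (rule Lim_transform_eventually)
    also have "?I f / ?I (\<lambda>_. 1) = integral\<^sup>L (normal2 ((1 - c) / d) (b / d) ((1 - a) / d)) f"
      unfolding Z d_def using meas d_pos by (subst integral_normal2) (auto simp: d_def)
    finally show ?thesis .
  qed
  moreover have "a = \<alpha>1 * J1" "b = sqrt (\<alpha>1 * \<alpha>2) * Jb" "c = \<alpha>2 * J2"
    by (simp_all add: a_def b_def c_def)
  ultimately show ?thesis
    using d_def b2 unfolding weak_conv2_def Let_def by simp
qed

end
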